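(* Let $B$ be a finite-dimensional unital $C^*$-algebra, $f\colon B\to\mathbb{C}$ a state, and $e\in[0,1]_B$ an effect. If $f(e)\neq 0,1$, then there exist unique states $f|e,\ f|e^{\perp}\colon B\to\mathbb{C}$ such that $$\mathrm{char}_{f(e)}\circ\big((f|e)\times(f|e^{\perp})\big)=f\circ\mathrm{char}_e\colon\ B\times B\to\mathbb{C},$$ and they can be given, for $b\in B$, by the formulas $$(f|e)(b)=\frac{f(\sqrt{e}\,b\,\sqrt{e})}{f(e)},\qquad (f|e^{\perp})(b)=\frac{f(\sqrt{1-e}\,b\,\sqrt{1-e})}{f(1-e)} .$$
   Context: $C^*$-algebras are unital, over $\mathbb{C}$, and finite-dimensional. A state on $B$ is a positive unital linear map $B\to\mathbb{C}$. The effects of a $C^*$-algebra $A$ are $[0,1]_A=\{a\in A\mid 0\le a\le 1\}$, with $e^{\perp}=1-e$. $A\times A$ is the direct sum $C^*$-algebra with pointwise operations, and $(g_1\times g_2)(b_1,b_2)=(g_1(b_1),g_2(b_2))$. For $e\in[0,1]_A$ the characteristic map $\mathrm{char}_e\colon A\times A\to A$ is $\mathrm{char}_e(a,a')=\sqrt{e}\,a\,\sqrt{e}+\sqrt{1-e}\,a'\,\sqrt{1-e}$; in particular, for $r\in[0,1]=[0,1]_{\mathbb{C}}$, $\mathrm{char}_r(z,z')=rz+(1-r)z'$. *)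

theory Defs
  imports Complex_Main
begin

text \<open>
  Unital \<open>C\<^sup>*\<close>-algebras over the complex numbers. The unit comes from \<^class>\<open>monoid_mult\<close> and not
  from \<^class>\<open>ring_1\<close>, so that the zero algebra is not excluded.
\<close>

class unital_cstar_algebra = real_normed_algebra + complete_space + monoid_mult +
  fixes scaleC :: "complex \<Rightarrow> 'a \<Rightarrow> 'a"  (infixr \<open>*\<^sub>C\<close> 75)
    and star :: "'a \<Rightarrow> 'a"
  assumes scaleC_add_right: "c *\<^sub>C (x + y) = c *\<^sub>C x + c *\<^sub>C y"
    and scaleC_add_left: "(c + d) *\<^sub>C x = c *\<^sub>C x + d *\<^sub>C x"
    and scaleC_scaleC: "c *\<^sub>C (d *\<^sub>C x) = (c * d) *\<^sub>C x"
    and scaleC_one: "1 *\<^sub>C x = x"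
    and scaleR_scaleC: "r *\<^sub>R x = complex_of_real r *\<^sub>C x"
    and mult_scaleC_left: "(c *\<^sub>C x) * y = c *\<^sub>C (x * y)"
    and mult_scaleC_right: "x * (c *\<^sub>C y) = c *\<^sub>C (x * y)"
    and norm_scaleC: "norm (c *\<^sub>C x) = cmod c * norm x"
    and star_star: "star (star x) = x"
    and star_add: "star (x + y) = star x + star y"
    and star_scaleC: "star (c *\<^sub>C x) = cnj c *\<^sub>C star x"
    and star_mult: "star (x * y) = star y * star x"
    and cstar_identity: "norm (star x * x) = (norm x)\<^sup>2"

class fd_cstar_algebra = unital_cstar_algebra +
  assumes finite_dimensional: "\<exists>S. finite S \<and> (\<forall>x. \<exists>u. x = (\<Sum>v\<in>S. u v *\<^sub>C v))"

lemma vector_space_scaleC: "vector_space (scaleC :: complex \<Rightarrow> 'a::unital_cstar_algebra \<Rightarrow> 'a)"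
  by standard (simp_all add: scaleC_add_right scaleC_add_left scaleC_scaleC scaleC_one)

instantiation complex :: fd_cstar_algebra
begin

definition scaleC_complex :: "complex \<Rightarrow> complex \<Rightarrow> complex" where
  "scaleC_complex c z = c * z"

definition star_complex :: "complex \<Rightarrow> complex" where
  "star_complex z = cnj z"

instance
proof
  show "\<exists>S::complex set. finite S \<and> (\<forall>x. \<exists>u. x = (\<Sum>v\<in>S. u v *\<^sub>C v))"
    by (rule exI[of _ "{1}"]) (auto simp: scaleC_complex_def intro: exI[of _ "\<lambda>_. _"])
qed (simp_all add: scaleC_complex_def star_complex_def algebra_simps norm_mult
       scaleR_conv_of_real power2_eq_square)

end

definition positive :: "'a::unital_cstar_algebra \<Rightarrow> bool" where
  "positive a \<longleftrightarrow> (\<exists>x. a = star x * x)"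

text \<open>The order is \<open>a \<le> b \<longleftrightarrow> positive (b - a)\<close>, so this says \<open>0 \<le> e \<le> 1\<close>.\<close>

definition effect :: "'a::unital_cstar_algebra \<Rightarrow> bool" where
  "effect e \<longleftrightarrow> positive e \<and> positive (1 - e)"

text \<open>
  A positive element has exactly one positive square root; elsewhere the value is unspecified.
\<close>

definition pos_sqrt :: "'a::unital_cstar_algebra \<Rightarrow> 'a" where
  "pos_sqrt a = (THE b. positive b \<and> b * b = a)"

definition state :: "('a::unital_cstar_algebra \<Rightarrow> complex) \<Rightarrow> bool" where
  "state f \<longleftrightarrow> Vector_Spaces.linear scaleC scaleC f \<and> (\<forall>a. positive a \<longrightarrow> positive (f a)) \<and> f 1 = 1"

text \<open>
  The sum \<open>A \<oplus> A\<close> appears only as the domain of \<open>char_map\<close>, so the plain product type suffices and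
  its (Euclidean) product norm, which is not a \<open>C\<^sup>*\<close>-norm, plays no role.
\<close>

definition char_map :: "'a::unital_cstar_algebra \<Rightarrow> 'a \<times> 'a \<Rightarrow> 'a" where
  "char_map e = (\<lambda>(a, a'). pos_sqrt e * a * pos_sqrt e + pos_sqrt (1 - e) * a' * pos_sqrt (1 - e))"

lemma positive_complex_iff: "positive (z::complex) \<longleftrightarrow> (\<exists>r\<ge>0. z = complex_of_real r)"
proof
  assume "positive z"
  then obtain x where "z = cnj x * x" by (auto simp: positive_def star_complex_def)
  then have "z = complex_of_real ((cmod x)\<^sup>2)"
    unfolding complex_norm_square by (simp add: mult.commute)
  then show "\<exists>r\<ge>0. z = complex_of_real r" by (intro exI[of _ "(cmod x)\<^sup>2"]) simp
next
  assume "\<exists>r\<ge>0. z = complex_of_real r"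
  then obtain r where r: "r \<ge> 0" "z = complex_of_real r" by blast
  then have "z = cnj (complex_of_real (sqrt r)) * complex_of_real (sqrt r)"
    by (simp flip: of_real_mult)
  then show "positive z" unfolding positive_def star_complex_def by blast
qed

lemma pos_sqrt_complex: "r \<ge> 0 \<Longrightarrow> pos_sqrt (complex_of_real r) = complex_of_real (sqrt r)"
  unfolding pos_sqrt_def
proof (rule the_equality)
  assume r: "r \<ge> 0"
  then show "positive (complex_of_real (sqrt r)) \<and>
      complex_of_real (sqrt r) * complex_of_real (sqrt r) = complex_of_real r"
    by (auto simp: positive_complex_iff simp flip: of_real_mult)
next
  fix b assume "positive b \<and> b * b = complex_of_real r"
  then obtain s where s: "s \<ge> 0" "b = complex_of_real s" "b * b = complex_of_real r"
    by (auto simp: positive_complex_iff)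
  then have "s * s = r" by (metis of_real_eq_iff of_real_mult)
  with s show "b = complex_of_real (sqrt r)" by auto
qed

lemma char_map_complex:
  assumes "0 \<le> r" "r \<le> 1"
  shows "char_map (complex_of_real r) (z, z') = r * z + (1 - r) * z'"
proof -
  have compl: "pos_sqrt (1 - complex_of_real r) = complex_of_real (sqrt (1 - r))"
    using pos_sqrt_complex[of "1 - r"] assms by simp
  have conj: "complex_of_real (sqrt s) * w * complex_of_real (sqrt s) = s * w"
    if "s \<ge> 0" for s w
  proof -
    have "complex_of_real (sqrt s) * complex_of_real (sqrt s) = s"
      using that by (simp flip: of_real_mult)
    then show ?thesis by (metis mult.assoc mult.commute)
  qed
  show ?thesis
    using assms conj[of r z] conj[of "1 - r" z']
    unfolding char_map_def prod.case compl pos_sqrt_complex[OF assms(1)]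
    by (simp only: of_real_diff of_real_1 diff_ge_0_iff_ge)
qed

end

theory Submission imports Defs
begin

text \<open>
  The formulas define states because \<open>sqrt e\<close> is self-adjoint with square \<open>e\<close>, and evaluating the
  equation at \<open>(b, 0)\<close> and \<open>(0, b)\<close> forces them. The substance lies in the existence and uniqueness
  of positive square roots, where positive means of the form \<open>star x * x\<close>. Existence is the binomial
  series for \<open>sqrt (1 - x)\<close>, which converges for \<open>norm x \<le> 1\<close>, once one knows that \<open>star x * x\<close> lies
  in the cone of self-adjoint \<open>a\<close> with \<open>norm (t - a) \<le> t\<close> for some real \<open>t\<close>. This is Kaplansky's
  argument: with \<open>n\<close> the negative part of \<open>star x * x\<close> and \<open>y = x * n\<close>, both \<open>star y * y\<close> and
  \<open>y * star y\<close> are negative, while their sum is a sum of squares of self-adjoint elements, so \<open>y = 0\<close>.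
\<close>

section \<open>Elementary rules for the involution and the norm\<close>

instance unital_cstar_algebra \<subseteq> banach ..

lemma scaleC_minus_one: "(-1) *\<^sub>C x = - (x::'a::unital_cstar_algebra)"
  using scaleR_scaleC[of "-1" x] by simp

lemma scaleC_zero_right: "c *\<^sub>C (0::'a::unital_cstar_algebra) = 0"
  using scaleC_add_right[of c "0::'a" 0] by simp

lemma scaleC_minus_right: "c *\<^sub>C (- x) = - (c *\<^sub>C (x::'a::unital_cstar_algebra))"
  using scaleC_add_right[of c x "-x"] by (simp add: scaleC_zero_right eq_neg_iff_add_eq_0 add.commute)

lemma scaleC_diff_right: "c *\<^sub>C (x - y) = c *\<^sub>C x - c *\<^sub>C (y::'a::unital_cstar_algebra)"
  using scaleC_add_right[of c x "-y"] by (simp add: scaleC_minus_right)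

lemma star_scaleR: "star (r *\<^sub>R x) = r *\<^sub>R star (x::'a::unital_cstar_algebra)"
  by (simp add: scaleR_scaleC star_scaleC)

lemma star_zero: "star 0 = (0::'a::unital_cstar_algebra)"
  using star_scaleR[of 0 "0::'a"] by simp

lemma star_minus: "star (- x) = - star (x::'a::unital_cstar_algebra)"
  using star_scaleR[of "-1" x] by simp

lemma star_diff: "star (x - y) = star x - star (y::'a::unital_cstar_algebra)"
  using star_add[of x "-y"] by (simp add: star_minus)

lemma star_one: "star 1 = (1::'a::unital_cstar_algebra)"
  by (metis mult.left_neutral mult.right_neutral star_mult star_star)

lemmas star_simps = star_star star_add star_scaleC star_mult star_scaleR star_zero star_minus
  star_diff star_one

lemma norm_star_le: "norm x \<le> norm (star (x::'a::unital_cstar_algebra))"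
proof (cases "norm x = 0")
  case False
  have "norm x * norm x \<le> norm (star x) * norm x"
    using norm_mult_ineq[of "star x" x] by (simp add: cstar_identity power2_eq_square)
  with False show ?thesis by (simp add: mult_le_cancel_right)
qed simp

lemma norm_star: "norm (star x) = norm (x::'a::unital_cstar_algebra)"
  using norm_star_le[of x] norm_star_le[of "star x"] by (simp add: star_star)

lemma bounded_linear_star: "bounded_linear (star :: 'a::unital_cstar_algebra \<Rightarrow> 'a)"
  by (rule bounded_linear_intro[where K = 1]) (simp_all add: star_simps norm_star)

text \<open>The identity forces \<open>norm 1\<close> to be 0 or 1; the value 0 occurs in the zero
  algebra.\<close>

lemma norm_one_le: "norm (1::'a::unital_cstar_algebra) \<le> 1"
proof -
  have "norm (1::'a) = norm (1::'a) * norm (1::'a)"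
    using cstar_identity[of "1::'a"] by (simp add: star_one power2_eq_square)
  then show ?thesis by auto
qed

lemma star_mult_self_eq_0: "star x * x = 0 \<Longrightarrow> x = (0::'a::unital_cstar_algebra)"
  using cstar_identity[of x] by simp

lemma norm_square_selfadjoint: "star h = h \<Longrightarrow> norm (h * h) = (norm (h::'a::unital_cstar_algebra))\<^sup>2"
  using cstar_identity[of h] by simp

lemma norm_power_le: "norm (x ^ n) \<le> norm (x::'a::unital_cstar_algebra) ^ n"
proof (induction n)
  case 0
  then show ?case using norm_one_le by simp
next
  case (Suc n)
  have "norm (x * x ^ n) \<le> norm x * norm (x ^ n)" by (rule norm_mult_ineq)
  also have "\<dots> \<le> norm x * norm x ^ n" using Suc by (simp add: mult_left_mono)
  finally show ?case by simp
qed

lemma star_power: "star (x ^ n) = star (x::'a::unital_cstar_algebra) ^ n"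
  by (induction n) (simp_all add: star_simps power_commutes)

section \<open>Square roots from the binomial series\<close>

text \<open>The Taylor coefficients of \<open>sqrt (1 - x)\<close>.\<close>

definition sqrt_coeff :: "nat \<Rightarrow> real" where
  "sqrt_coeff n = pochhammer (-1/2) n / fact n"

lemma sqrt_coeff_gbinomial: "sqrt_coeff n = (-1) ^ n * ((1/2) gchoose n)"
  by (simp add: sqrt_coeff_def gbinomial_pochhammer flip: power_add mult.assoc)

lemma sqrt_coeff_0: "sqrt_coeff 0 = 1"
  by (simp add: sqrt_coeff_def)

lemma pochhammer_half_nonneg: "0 \<le> pochhammer (1/2::real) n"
  by (intro less_imp_le pochhammer_pos) simp

lemma sqrt_coeff_Suc_le_0: "sqrt_coeff (Suc n) \<le> 0"
  using pochhammer_half_nonneg[of n] by (simp add: sqrt_coeff_def pochhammer_rec)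

text \<open>Alternating partial sums of binomial coefficients are again binomial coefficients up to
  sign, here those of exponent -1/2.\<close>

lemma sum_sqrt_coeff_nonneg: "0 \<le> (\<Sum>k\<le>n. sqrt_coeff k)"
proof -
  have "(\<Sum>k\<le>n. sqrt_coeff k) = (\<Sum>k\<le>n. ((1/2) gchoose k) * (-1) ^ k)"
    by (simp add: sqrt_coeff_gbinomial mult.commute)
  also have "\<dots> = (-1) ^ n * (- (1/2) gchoose n)"
    by (subst gbinomial_sum_lower_neg) simp
  also have "\<dots> = pochhammer (1/2) n / fact n"
    by (simp add: gbinomial_pochhammer flip: power_add mult.assoc)
  finally show ?thesis using pochhammer_half_nonneg[of n] by simp
qed

text \<open>All coefficients after the zeroth are at most 0, so their absolute values sum to 1 minus
  a nonnegative partial sum.\<close>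

lemma sum_abs_sqrt_coeff_le: "(\<Sum>k<n. \<bar>sqrt_coeff (Suc k)\<bar>) \<le> 1"
proof -
  have "(\<Sum>k<n. \<bar>sqrt_coeff (Suc k)\<bar>) = - (\<Sum>k<n. sqrt_coeff (Suc k))"
    using sqrt_coeff_Suc_le_0 by (simp add: sum_negf abs_of_nonpos)
  also have "\<dots> = 1 - (\<Sum>k\<le>n. sqrt_coeff k)"
    by (simp add: lessThan_Suc_atMost[symmetric] sum.lessThan_Suc_shift sqrt_coeff_0 del: sum.lessThan_Suc)
  finally show ?thesis using sum_sqrt_coeff_nonneg[of n] by simp
qed

text \<open>The Chu-Vandermonde identity turns the convolution into the coefficients of
  \<open>1 - x\<close>; from index 2 on, the rising factorial of -1 contains the factor 0.\<close>

lemma sqrt_coeff_convolution: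
  "(\<Sum>i\<le>n. sqrt_coeff i * sqrt_coeff (n - i)) = (if n = 0 then 1 else if n = 1 then -1 else 0)"
proof -
  have "(\<Sum>i\<le>n. sqrt_coeff i * sqrt_coeff (n - i))
      = (\<Sum>i\<le>n. real (n choose i) * pochhammer (-1/2) i * pochhammer (-1/2) (n - i)) / fact n"
    unfolding sum_divide_distrib
    by (rule sum.cong) (simp_all add: sqrt_coeff_def binomial_fact)
  also have "\<dots> = pochhammer (-1) n / fact n"
    using pochhammer_binomial_sum[of "-1/2::real" "-1/2" n] by simp
  also have "\<dots> = (if n = 0 then 1 else if n = 1 then -1 else 0)"
  proof (cases "n \<le> 1")
    case True
    then have "n = 0 \<or> n = 1" by auto
    then show ?thesis by auto
  next
    case False
    then obtain m where "n = Suc (Suc m)" by (metis One_nat_def Suc_le_D not_less_eq_eq)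
    then show ?thesis by (simp add: pochhammer_rec)
  qed
  finally show ?thesis .
qed

text \<open>A substitute for saying that \<open>c\<close> is a continuous function of \<open>a\<close>.\<close>

definition bicommutes :: "'a::unital_cstar_algebra \<Rightarrow> 'a \<Rightarrow> bool" where
  "bicommutes c a \<longleftrightarrow> (\<forall>z. z * a = a * z \<longrightarrow> z * c = c * z)"

lemma bicommutesD: "bicommutes c a \<Longrightarrow> z * a = a * z \<Longrightarrow> z * c = c * z"
  by (simp add: bicommutes_def)

text \<open>The binomial series in \<open>x = 1 - a\<close> converges absolutely even for
  \<open>norm x = 1\<close>, its coefficients being absolutely summable. The Cauchy product gives
  the square, and commutation passes to the limit by continuity of multiplication.\<close>

lemma sqrt_near_one:
  fixes a :: "'a::unital_cstar_algebra"
  assumes a: "star a = a" "norm (1 - a) \<le> 1"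
  shows "\<exists>c. star c = c \<and> norm (1 - c) \<le> 1 \<and> c * c = a \<and> bicommutes c a"
proof -
  define x where "x = 1 - a"
  define t where "t n = sqrt_coeff n *\<^sub>R x ^ n" for n
  have nx: "norm x ^ n \<le> 1" for n using a(2) by (simp add: x_def power_le_one)
  have nt: "norm (t n) \<le> \<bar>sqrt_coeff n\<bar>" for n
    using order_trans[OF norm_power_le[of x n] nx] by (simp add: t_def mult_left_le)
  have sq: "summable (\<lambda>n. \<bar>sqrt_coeff (Suc n)\<bar>)"
    by (rule summableI_nonneg_bounded[where x = 1]) (simp_all add: sum_abs_sqrt_coeff_le)
  then have sq0: "summable (\<lambda>n. \<bar>sqrt_coeff n\<bar>)" by (simp add: summable_Suc_iff[of "\<lambda>n. \<bar>sqrt_coeff n\<bar>"])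
  have snt: "summable (\<lambda>n. norm (t n))"
    by (rule summable_comparison_test'[OF sq0, where N = 0]) (simp add: nt)
  have st: "summable t" using snt by (rule summable_norm_cancel)
  define c where "c = suminf t"
  have "star x = x" by (simp add: x_def star_simps a)
  then have "star (t n) = t n" for n by (simp add: t_def star_simps star_power)
  then have 1: "star c = c"
    using bounded_linear.suminf[OF bounded_linear_star st] by (simp add: c_def)
  have "c = t 0 + (\<Sum>n. t (Suc n))" using suminf_split_head[OF st] by (simp add: c_def)
  then have "norm (1 - c) = norm (\<Sum>n. t (Suc n))" by (simp add: t_def sqrt_coeff_0)
  also have "\<dots> \<le> (\<Sum>n. norm (t (Suc n)))"
    using snt by (intro summable_norm) (subst summable_Suc_iff)
  also have "\<dots> \<le> (\<Sum>n. \<bar>sqrt_coeff (Suc n)\<bar>)"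
    using snt sq by (intro suminf_le nt) (simp_all add: summable_Suc_iff[of "\<lambda>n. norm (t n)"])
  also have "\<dots> \<le> 1"
    by (rule suminf_le_const[OF sq]) (rule sum_abs_sqrt_coeff_le)
  finally have 2: "norm (1 - c) \<le> 1" .
  have "(\<Sum>i\<le>n. t i * t (n - i)) = (\<Sum>i\<le>n. sqrt_coeff i * sqrt_coeff (n - i)) *\<^sub>R x ^ n" for n
    by (simp add: t_def scaleR_sum_left flip: power_add) (simp only: mult.commute)
  then have "(\<Sum>i\<le>n. t i * t (n - i)) = (if n = 0 then 1 else if n = 1 then - x else 0)" for n
    by (simp add: sqrt_coeff_convolution)
  then have "(\<lambda>n. if n = 0 then 1 else if n = 1 then - x else 0) sums (c * c)"
    using Cauchy_product_sums[OF snt snt] by (simp add: c_def)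
  moreover have "(\<lambda>n. if n = 0 then 1 else if n = 1 then - x else 0) sums
      (\<Sum>n\<in>{0,1::nat}. if n = 0 then 1 else if n = 1 then - x else 0)"
    by (rule sums_finite) auto
  ultimately have "c * c = (\<Sum>n\<in>{0,1::nat}. if n = 0 then 1 else if n = 1 then - x else 0)"
    by (rule sums_unique2)
  then have 3: "c * c = a" by (simp add: x_def)
  have "z * c = c * z" if "z * a = a * z" for z
  proof -
    have "x * z = z * x" using that by (simp add: x_def algebra_simps)
    then have "t n * z = z * t n" for n by (simp add: t_def power_commuting_commutes)
    then show ?thesis
      using bounded_linear.suminf[OF bounded_linear_mult_left[of z] st]
        bounded_linear.suminf[OF bounded_linear_mult_right[of z] st] by (simp add: c_def)
  qed
  then show ?thesis using 1 2 3 unfolding bicommutes_def by blast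
qed

section \<open>The positive cone\<close>

text \<open>
  For self-adjoint \<open>a\<close>, the existence of such a \<open>t\<close> means that the spectrum of \<open>a\<close> lies in
  \<open>[0, 2 * t]\<close>.
\<close>

definition nonneg :: "'a::unital_cstar_algebra \<Rightarrow> bool" where
  "nonneg a \<longleftrightarrow> star a = a \<and> (\<exists>t. norm (t *\<^sub>R 1 - a) \<le> t)"

lemma nonneg_star: "nonneg a \<Longrightarrow> star a = a"
  by (simp add: nonneg_def)

lemma nonnegI: "star a = a \<Longrightarrow> norm (t *\<^sub>R 1 - a) \<le> t \<Longrightarrow> nonneg a"
  by (auto simp: nonneg_def)

lemma norm_scaleR_one_le: "norm (r *\<^sub>R (1::'a::unital_cstar_algebra)) \<le> \<bar>r\<bar>"
  using norm_one_le[where ?'a = 'a] by (simp add: mult_left_le)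

lemma norm_scaleR_one_diff_mono:
  fixes a :: "'a::unital_cstar_algebra"
  assumes "norm (t *\<^sub>R 1 - a) \<le> t" "t \<le> u"
  shows "norm (u *\<^sub>R 1 - a) \<le> u"
proof -
  have "u *\<^sub>R 1 - a = (u - t) *\<^sub>R 1 + (t *\<^sub>R 1 - a)" by (simp add: algebra_simps)
  then have "norm (u *\<^sub>R 1 - a) \<le> norm ((u - t) *\<^sub>R (1::'a)) + norm (t *\<^sub>R 1 - a)"
    by (metis norm_triangle_ineq)
  then show ?thesis using norm_scaleR_one_le[of "u - t", where ?'a = 'a] assms by simp
qed

lemma nonneg_add:
  fixes a b :: "'a::unital_cstar_algebra"
  assumes "nonneg a" "nonneg b" shows "nonneg (a + b)"
proof -
  obtain s t where "norm (s *\<^sub>R 1 - a) \<le> s" "norm (t *\<^sub>R 1 - b) \<le> t"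
    using assms by (auto simp: nonneg_def)
  moreover have "(s + t) *\<^sub>R 1 - (a + b) = (s *\<^sub>R 1 - a) + (t *\<^sub>R 1 - b)"
    by (simp add: algebra_simps)
  ultimately have "norm ((s + t) *\<^sub>R 1 - (a + b)) \<le> s + t"
    using norm_triangle_mono by metis
  then show ?thesis using assms by (intro nonnegI) (simp_all add: star_simps nonneg_star)
qed

lemma nonneg_scaleR:
  fixes a :: "'a::unital_cstar_algebra"
  assumes "nonneg a" "0 \<le> r" shows "nonneg (r *\<^sub>R a)"
proof -
  obtain t where "norm (t *\<^sub>R 1 - a) \<le> t" using assms by (auto simp: nonneg_def)
  moreover have "(r * t) *\<^sub>R 1 - r *\<^sub>R a = r *\<^sub>R (t *\<^sub>R 1 - a)" by (simp add: algebra_simps)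
  ultimately have "norm ((r * t) *\<^sub>R 1 - r *\<^sub>R a) \<le> r * t"
    using assms(2) by (simp add: mult_left_mono)
  then show ?thesis using assms by (intro nonnegI) (simp_all add: star_simps nonneg_star)
qed

lemma nonneg_scaleR_one: "0 \<le> r \<Longrightarrow> nonneg (r *\<^sub>R (1::'a::unital_cstar_algebra))"
  by (rule nonnegI[where t = r]) (simp_all add: star_simps)

text \<open>After enlarging \<open>t\<close> to be positive, \<open>(1/t) *\<^sub>R a\<close> lies
  within distance 1 of the unit, so the series applies; its root is scaled back by
  \<open>sqrt t\<close>.\<close>

lemma nonneg_sqrt:
  fixes a :: "'a::unital_cstar_algebra"
  assumes "nonneg a"
  obtains c where "nonneg c" "c * c = a" "bicommutes c a"
proof -
  obtain t0 where "norm (t0 *\<^sub>R 1 - a) \<le> t0" using assms by (auto simp: nonneg_def)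
  then obtain t where t: "norm (t *\<^sub>R 1 - a) \<le> t" "t > 0"
    by (meson norm_scaleR_one_diff_mono less_add_one max.cobounded1 max.cobounded2 order_less_le_trans zero_less_one)
  have "1 - (1/t) *\<^sub>R a = (1/t) *\<^sub>R (t *\<^sub>R 1 - a)" using t(2) by (simp add: algebra_simps)
  then have "norm (1 - (1/t) *\<^sub>R a) = norm (t *\<^sub>R 1 - a) / t" using t by simp
  then have "norm (1 - (1/t) *\<^sub>R a) \<le> 1" using t by simp
  moreover have "star ((1/t) *\<^sub>R a) = (1/t) *\<^sub>R a" using assms by (simp add: star_simps nonneg_star)
  ultimately obtain c where c: "star c = c" "norm (1 - c) \<le> 1" "c * c = (1/t) *\<^sub>R a"
    "bicommutes c ((1/t) *\<^sub>R a)"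
    using sqrt_near_one by blast
  have "nonneg c" using c by (intro nonnegI[where t = 1]) simp_all
  then have "nonneg (sqrt t *\<^sub>R c)" using t by (intro nonneg_scaleR) simp_all
  moreover have "(sqrt t *\<^sub>R c) * (sqrt t *\<^sub>R c) = a" using t c(3) by simp
  moreover have "bicommutes (sqrt t *\<^sub>R c) a" using c(4) by (simp add: bicommutes_def)
  ultimately show ?thesis by (rule that)
qed

text \<open>
  With \<open>c = sqrt (1 - h * h)\<close> the element \<open>u = h + \<i> c\<close> is unitary, and
  \<open>1 - h * h\<close> is a combination of \<open>1\<close>, \<open>u * u\<close> and \<open>star (u * u)\<close>.
\<close>

lemma norm_one_minus_square_le:
  fixes h :: "'a::unital_cstar_algebra"
  assumes h: "star h = h" "norm h \<le> 1"
  shows "norm (1 - h * h) \<le> 1"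
proof -
  have "norm (h * h) \<le> 1" using h by (simp add: norm_square_selfadjoint power_le_one)
  then obtain c where c: "star c = c" "c * c = 1 - h * h" "bicommutes c (1 - h * h)"
    using sqrt_near_one[of "1 - h * h"] h(1) by (auto simp: star_simps)
  have "h * (1 - h * h) = (1 - h * h) * h" by (simp add: algebra_simps)
  then have hc: "h * c = c * h" by (rule bicommutesD[OF c(3)])
  define u where "u = h + \<i> *\<^sub>C c"
  define v where "v = h - \<i> *\<^sub>C c"
  have v: "star u = v" using scaleC_minus_one[of "\<i> *\<^sub>C c"]
    by (simp add: u_def v_def star_simps h c scaleC_scaleC)
  have ii: "\<i> *\<^sub>C \<i> *\<^sub>C z = - (z::'a)" for z
    using scaleC_minus_one[of z] by (simp add: scaleC_scaleC)
  have "star u * u = h * h + c * c"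
    by (simp add: v) (simp add: u_def v_def algebra_simps mult_scaleC_left mult_scaleC_right ii hc
      scaleC_minus_right scaleC_diff_right scaleC_add_right)
  then have "star u * u = 1" by (simp add: c)
  then have "(norm u)\<^sup>2 \<le> 1" using cstar_identity[of u] norm_one_le[where ?'a = 'a] by simp
  then have nu: "norm u \<le> 1" by (simp add: power2_le_iff_abs_le abs_square_le_1)
  have nv: "norm v \<le> 1" using nu norm_star[of u] by (simp add: v)
  have uu: "norm (u * u) \<le> 1" "norm (v * v) \<le> 1"
    using norm_mult_ineq[of u u] norm_mult_ineq[of v v] mult_le_one[OF nu _ nu] mult_le_one[OF nv _ nv]
    by simp_all
  have "u * u + v * v = 2 *\<^sub>R (h * h) - 2 *\<^sub>R (c * c)"
    by (simp add: u_def v_def algebra_simps mult_scaleC_left mult_scaleC_right ii hc scaleC_minus_right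
      scaleC_diff_right scaleC_add_right scaleR_2)
  then have "4 *\<^sub>R (1 - h * h) = 2 *\<^sub>R 1 - u * u - v * v"
    by (simp add: c diff_diff_eq) (simp add: algebra_simps flip: scaleR_left.add)
  then have "norm (4 *\<^sub>R (1 - h * h)) \<le> 4"
    using norm_triangle_ineq4[of "2 *\<^sub>R 1 - u * u" "v * v"] norm_triangle_ineq4[of "2 *\<^sub>R 1" "u * u"]
      norm_scaleR_one_le[of 2, where ?'a = 'a] uu by simp
  then show ?thesis by simp
qed


lemma norm_square_bound:
  fixes h :: "'a::unital_cstar_algebra"
  assumes h: "star h = h"
  shows "norm ((norm h)\<^sup>2 *\<^sub>R 1 - h * h) \<le> (norm h)\<^sup>2"
proof (cases "h = 0")
  case False
  define k where "k = (1 / norm h) *\<^sub>R h"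
  have "norm (1 - k * k) \<le> 1"
    using False h by (intro norm_one_minus_square_le) (simp_all add: k_def star_simps)
  moreover have "(norm h)\<^sup>2 *\<^sub>R 1 - h * h = (norm h)\<^sup>2 *\<^sub>R (1 - k * k)"
    using False by (simp add: k_def algebra_simps power2_eq_square)
  ultimately show ?thesis by (simp add: mult_left_le)
qed simp

lemma nonneg_square: "star h = h \<Longrightarrow> nonneg (h * (h::'a::unital_cstar_algebra))"
  by (rule nonnegI[OF _ norm_square_bound]) (simp_all add: star_simps)

text \<open>A root \<open>c\<close> of \<open>a\<close> satisfies
  \<open>(norm c)\<^sup>2 = norm a\<close>, so the radius depends only on a bound for the norm. This
  uniformity is what permits limits of positive elements.\<close>

lemma nonneg_norm_bound:
  fixes a :: "'a::unital_cstar_algebra"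
  assumes "nonneg a" "norm a \<le> K"
  shows "norm (K *\<^sub>R 1 - a) \<le> K"
proof -
  obtain c where c: "nonneg c" "c * c = a" using assms(1) by (rule nonneg_sqrt)
  then have "star c = c" by (simp add: nonneg_star)
  then have "norm ((norm c)\<^sup>2 *\<^sub>R 1 - a) \<le> (norm c)\<^sup>2" "(norm c)\<^sup>2 \<le> K"
    using norm_square_bound[of c] norm_square_selfadjoint[of c] c assms(2) by simp_all
  then show ?thesis by (rule norm_scaleR_one_diff_mono)
qed

text \<open>Bicommuting roots of commuting elements commute, so \<open>a * b\<close> is the square
  of the self-adjoint product of the roots.\<close>

lemma nonneg_mult:
  fixes a b :: "'a::unital_cstar_algebra"
  assumes "nonneg a" "nonneg b" "a * b = b * a"
  shows "nonneg (a * b)"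
proof -
  obtain c where c: "nonneg c" "c * c = a" "bicommutes c a" using assms(1) by (rule nonneg_sqrt)
  obtain d where d: "nonneg d" "d * d = b" "bicommutes d b" using assms(2) by (rule nonneg_sqrt)
  have "b * c = c * b" by (rule bicommutesD[OF c(3)]) (simp add: assms(3))
  then have cd: "c * d = d * c" by (intro bicommutesD[OF d(3)]) simp
  have "(c * d) * (c * d) = c * (d * c) * d" by (simp add: mult.assoc)
  also have "\<dots> = c * c * (d * d)" unfolding cd[symmetric] by (simp add: mult.assoc)
  finally have "a * b = (c * d) * (c * d)" by (simp add: c d)
  moreover have "star (c * d) = c * d" using c d cd by (simp add: star_simps nonneg_star)
  ultimately show ?thesis using nonneg_square by metis
qed

text \<open>Let \<open>c\<close> and \<open>d\<close> be commuting roots of \<open>a\<close> and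
  \<open>- a\<close>. Then \<open>z = c + \<i> *\<^sub>C d\<close> satisfies
  \<open>star z * z = a - a = 0\<close>; adding \<open>z = 0\<close> and its adjoint gives
  \<open>c = 0\<close>.\<close>

lemma nonneg_antisym:
  fixes a :: "'a::unital_cstar_algebra"
  assumes "nonneg a" "nonneg (- a)"
  shows "a = 0"
proof -
  obtain c where c: "nonneg c" "c * c = a" "bicommutes c a" using assms(1) by (rule nonneg_sqrt)
  obtain d where d: "nonneg d" "d * d = - a" "bicommutes d (- a)"
    using assms(2) by (rule nonneg_sqrt)
  have "a * c = c * a" using c(2) mult.assoc by metis
  then have cd: "c * d = d * c" by (intro bicommutesD[OF d(3)]) simp
  define z where "z = c + \<i> *\<^sub>C d"
  have ii: "\<i> *\<^sub>C \<i> *\<^sub>C z = - (z::'a)" for z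
    using scaleC_minus_one[of z] by (simp add: scaleC_scaleC)
  have sz: "star z = c - \<i> *\<^sub>C d"
    using c(1) d(1) scaleC_minus_one[of "\<i> *\<^sub>C d"]
    by (simp add: z_def star_simps nonneg_star scaleC_scaleC)
  have "star z * z = c * c + d * d"
    unfolding sz by (simp add: z_def algebra_simps mult_scaleC_left mult_scaleC_right ii cd scaleC_minus_right
      scaleC_diff_right scaleC_add_right)
  also have "\<dots> = 0" by (simp add: c(2) d(2))
  finally have "z = 0" by (rule star_mult_self_eq_0)
  moreover from this have "c - \<i> *\<^sub>C d = 0"
    using sz by (simp add: star_zero)
  ultimately have "c + c = 0" by (simp add: z_def)
  then have "2 *\<^sub>R c = 0" by (simp add: scaleR_2)
  then show ?thesis using c(2) by simp
qed

section \<open>Invertibility and positivity\<close>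

definition has_inverse :: "'a::unital_cstar_algebra \<Rightarrow> bool" where
  "has_inverse a \<longleftrightarrow> (\<exists>r. a * r = 1 \<and> r * a = 1)"

text \<open>Neumann series: the product with \<open>1 - x\<close> telescopes on either side.\<close>

lemma has_inverse_one_minus:
  fixes x :: "'a::unital_cstar_algebra"
  assumes "norm x < 1"
  shows "has_inverse (1 - x)"
proof -
  have "summable (\<lambda>n. norm x ^ n)" using assms by (simp add: summable_geometric)
  then have s: "summable (\<lambda>n. x ^ n)"
    by (rule summable_comparison_test'[where N = 0]) (simp add: norm_power_le)
  then have "(\<lambda>n. x ^ n - x ^ Suc n) sums (x ^ 0 - 0)"
    by (intro telescope_sums' summable_LIMSEQ_zero)
  then have "(\<Sum>n. x ^ n - x ^ Suc n) = 1" by (simp add: sums_iff)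
  moreover have "(1 - x) * (\<Sum>n. x ^ n) = (\<Sum>n. x ^ n - x ^ Suc n)"
    using bounded_linear.suminf[OF bounded_linear_mult_right[of "1 - x"] s] by (simp add: algebra_simps)
  moreover have "(\<Sum>n. x ^ n) * (1 - x) = (\<Sum>n. x ^ n - x ^ Suc n)"
    using bounded_linear.suminf[OF bounded_linear_mult_left[of "1 - x"] s]
    by (simp add: algebra_simps power_commutes)
  ultimately show ?thesis by (auto simp: has_inverse_def)
qed

lemma has_inverse_scaleR:
  assumes "has_inverse a" "s \<noteq> 0"
  shows "has_inverse (s *\<^sub>R a)"
proof -
  obtain r where "a * r = 1" "r * a = 1" using assms by (auto simp: has_inverse_def)
  then show ?thesis using assms(2) by (auto simp: has_inverse_def intro!: exI[of _ "(1/s) *\<^sub>R r"])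
qed

lemma has_inverse_factor:
  assumes "has_inverse (u * v)" "u * v = v * u"
  shows "has_inverse u"
proof -
  obtain r where r: "(u * v) * r = 1" "r * (u * v) = 1" using assms by (auto simp: has_inverse_def)
  have l: "(r * v) * u = 1" using r(2) by (simp add: assms(2) mult.assoc)
  have "u * (v * r) = 1" using r(1) by (simp add: mult.assoc)
  moreover from this l have "r * v = v * r"
    by (metis mult.assoc mult.left_neutral mult.right_neutral)
  ultimately show ?thesis using l by (auto simp: has_inverse_def)
qed

text \<open>The shifted element is \<open>s + t\<close> times \<open>1 - x\<close>, where
  \<open>norm x\<close> is at most \<open>s / (s + t)\<close>, hence below 1.\<close>

lemma has_inverse_shift_nonneg:
  fixes a :: "'a::unital_cstar_algebra"
  assumes "nonneg a" "0 < t"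
  shows "has_inverse (t *\<^sub>R 1 + a)"
proof -
  obtain s where s: "norm (s *\<^sub>R 1 - a) \<le> s" using assms by (auto simp: nonneg_def)
  then have "0 \<le> s" using norm_ge_zero order_trans by blast
  define x where "x = (1 / (s + t)) *\<^sub>R (s *\<^sub>R 1 - a)"
  have "norm x < 1" using s \<open>0 \<le> s\<close> assms(2) by (simp add: x_def divide_less_eq)
  then have "has_inverse ((s + t) *\<^sub>R (1 - x))"
    using \<open>0 \<le> s\<close> assms(2) by (intro has_inverse_scaleR has_inverse_one_minus) simp_all
  moreover have "(s + t) *\<^sub>R (1 - x) = t *\<^sub>R 1 + a"
    using \<open>0 \<le> s\<close> assms(2) by (simp add: x_def scaleR_diff_right) (simp add: algebra_simps)
  ultimately show ?thesis by simp
qed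

text \<open>For small \<epsilon> and the inverse \<open>r\<close> of \<open>a\<close>, the element
  \<open>1 - \<epsilon> *\<^sub>R r\<close> is positive; multiplying by the commuting
  \<open>a\<close> gives the bound.\<close>

lemma nonneg_has_inverse_lower_bound:
  fixes a :: "'a::unital_cstar_algebra"
  assumes "nonneg a" "has_inverse a"
  obtains \<epsilon> where "0 < \<epsilon>" "nonneg (a - \<epsilon> *\<^sub>R 1)"
proof -
  obtain r where r: "a * r = 1" "r * a = 1" using assms(2) by (auto simp: has_inverse_def)
  have "star r * a = 1" using arg_cong[OF r(1), of star] assms(1) by (simp add: star_simps nonneg_star)
  then have sr: "star r = r" by (metis mult.assoc mult.left_neutral mult.right_neutral r(1))
  define \<epsilon> where "\<epsilon> = 1 / (norm r + 1)"
  have e: "0 < \<epsilon>" by (simp add: \<epsilon>_def add_nonneg_pos)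
  have "norm (\<epsilon> *\<^sub>R r) \<le> 1"
    by (simp add: \<epsilon>_def divide_le_eq_1 add_nonneg_pos abs_of_nonneg)
  then have "nonneg (1 - \<epsilon> *\<^sub>R r)" by (intro nonnegI[where t = 1]) (simp_all add: star_simps sr)
  then have "nonneg (a * (1 - \<epsilon> *\<^sub>R r))"
    by (intro nonneg_mult assms) (simp_all add: algebra_simps r)
  then show ?thesis using e that by (simp add: algebra_simps r)
qed

lemma nonneg_shift_mono:
  fixes h :: "'a::unital_cstar_algebra"
  assumes "nonneg (s *\<^sub>R 1 + h)" "s \<le> t"
  shows "nonneg (t *\<^sub>R 1 + h)"
proof -
  have "t *\<^sub>R 1 + h = (t - s) *\<^sub>R 1 + (s *\<^sub>R 1 + h)" by (simp add: algebra_simps)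
  then show ?thesis using assms by (metis nonneg_add nonneg_scaleR_one diff_ge_0_iff_ge)
qed

text \<open>
  The infimum \<open>m\<close> of the shifts that make \<open>h\<close> positive is attained; if \<open>m\<close> were nonzero, invertibility
  of \<open>m + h\<close> would allow a smaller shift.
\<close>

lemma nonneg_if_has_inverse_shift:
  fixes h :: "'a::unital_cstar_algebra"
  assumes h: "star h = h" and inv: "\<And>t. 0 < t \<Longrightarrow> has_inverse (t *\<^sub>R 1 + h)"
  shows "nonneg h"
proof -
  define T where "T = {t. 0 \<le> t \<and> nonneg (t *\<^sub>R 1 + h)}"
  define m where "m = Inf T"
  have "nonneg (norm h *\<^sub>R 1 + h)" by (rule nonnegI[where t = "norm h"]) (simp_all add: star_simps h)
  then have ne: "norm h \<in> T" by (simp add: T_def)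
  have bdd: "bdd_below T" by (auto simp: T_def)
  have "0 \<le> m" using ne by (auto simp: m_def T_def intro!: cInf_greatest)
  \<comment> \<open>One radius \<open>K\<close> serves all shifts within 1 of \<open>m\<close>, so
    the shift can tend to \<open>m\<close>.\<close>
  define K where "K = norm (m *\<^sub>R 1 + h) + 1"
  have "norm (K *\<^sub>R 1 - (m *\<^sub>R 1 + h)) \<le> K + \<epsilon>" if \<epsilon>: "0 < \<epsilon>" for \<epsilon>
  proof -
    obtain t where t: "t \<in> T" "t < m + min \<epsilon> 1"
      using cInf_lessD[of T "m + min \<epsilon> 1"] ne \<epsilon> by (auto simp: m_def)
    have "m \<le> t" using bdd t by (simp add: m_def cInf_lower)
    have e: "t *\<^sub>R 1 + h = (m *\<^sub>R 1 + h) + (t - m) *\<^sub>R 1" by (simp add: algebra_simps)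
    have d: "norm ((t - m) *\<^sub>R (1::'a)) \<le> min \<epsilon> 1"
      using norm_scaleR_one_le[of "t - m", where ?'a = 'a] \<open>m \<le> t\<close> t by linarith
    have "norm (t *\<^sub>R 1 + h) \<le> K" unfolding e K_def by (rule norm_triangle_mono) (use d in auto)
    then have "norm (K *\<^sub>R 1 - (t *\<^sub>R 1 + h)) \<le> K"
      using t by (intro nonneg_norm_bound) (auto simp: T_def)
    moreover have "K *\<^sub>R 1 - (m *\<^sub>R 1 + h) = (K *\<^sub>R 1 - (t *\<^sub>R 1 + h)) + (t - m) *\<^sub>R 1"
      by (simp add: algebra_simps)
    ultimately show ?thesis using d norm_triangle_mono by (metis min.boundedE)
  qed
  then have "norm (K *\<^sub>R 1 - (m *\<^sub>R 1 + h)) \<le> K" by (rule field_le_epsilon)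
  then have m: "nonneg (m *\<^sub>R 1 + h)" by (intro nonnegI) (simp_all add: star_simps h)
  have "m = 0"
  proof (rule ccontr)
    assume "m \<noteq> 0"
    then have "0 < m" using \<open>0 \<le> m\<close> by simp
    obtain \<epsilon> where \<epsilon>: "0 < \<epsilon>" "nonneg ((m *\<^sub>R 1 + h) - \<epsilon> *\<^sub>R 1)"
      using nonneg_has_inverse_lower_bound[OF m inv[OF \<open>0 < m\<close>]] by blast
    have "(m *\<^sub>R 1 + h) - \<epsilon> *\<^sub>R 1 = (m - \<epsilon>) *\<^sub>R 1 + h" by (simp add: algebra_simps)
    with \<epsilon>(2) have "nonneg ((m - \<epsilon>) *\<^sub>R 1 + h)" by metis
    \<comment> \<open>Shifts in \<open>T\<close> are nonnegative, hence the truncation at 0.\<close>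
    then have "nonneg (max 0 (m - \<epsilon>) *\<^sub>R 1 + h)" by (rule nonneg_shift_mono) simp
    then have "m \<le> max 0 (m - \<epsilon>)" using bdd by (simp add: m_def T_def cInf_lower)
    then show False using \<epsilon>(1) \<open>0 < m\<close> by simp
  qed
  then show ?thesis using m by simp
qed

text \<open>Here \<open>b\<close> acts as the absolute value of \<open>a\<close>. As the squares
  agree, \<open>(t + b - a) * (t + b + a)\<close> equals \<open>2 * t\<close> times
  \<open>t / 2 + b\<close>, which is invertible; hence so is each of the commuting factors.\<close>

lemma nonneg_diff_if_square_eq:
  fixes a b :: "'a::unital_cstar_algebra"
  assumes "star a = a" "nonneg b" "a * b = b * a" "b * b = a * a"
  shows "nonneg (b - a)"
proof (rule nonneg_if_has_inverse_shift)
  fix t :: real assume t: "0 < t"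
  have "(t *\<^sub>R 1 + (b - a)) * (t *\<^sub>R 1 + (b + a)) = (2 * t) *\<^sub>R ((t / 2) *\<^sub>R 1 + b)"
    using assms(3,4) by (simp add: algebra_simps flip: scaleR_left.add)
  moreover have "has_inverse ((2 * t) *\<^sub>R ((t / 2) *\<^sub>R 1 + b))"
    using t assms(2) by (intro has_inverse_scaleR has_inverse_shift_nonneg) simp_all
  moreover have "(t *\<^sub>R 1 + (b - a)) * (t *\<^sub>R 1 + (b + a)) = (t *\<^sub>R 1 + (b + a)) * (t *\<^sub>R 1 + (b - a))"
    by (simp add: algebra_simps assms(3))
  ultimately show "has_inverse (t *\<^sub>R 1 + (b - a))"
    using has_inverse_factor by metis
qed (simp add: star_simps assms nonneg_star)

text \<open>Away from \<open>0\<close>, the spectra of \<open>star y * y\<close> and \<open>y * star y\<close> agree.\<close>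

lemma nonneg_minus_mult_star:
  fixes y :: "'a::unital_cstar_algebra"
  assumes "nonneg (- (star y * y))"
  shows "nonneg (- (y * star y))"
proof (rule nonneg_if_has_inverse_shift)
  fix t :: real assume t: "0 < t"
  define w where "w = star y"
  obtain r where r: "(t *\<^sub>R 1 - w * y) * r = 1" "r * (t *\<^sub>R 1 - w * y) = 1"
    using has_inverse_shift_nonneg[OF assms t] by (auto simp: has_inverse_def w_def)
  have r1: "w * (y * r) = t *\<^sub>R r - 1" using r(1) by (simp add: algebra_simps)
  have r2: "r * (w * y) = t *\<^sub>R r - 1" using r(2) by (simp add: algebra_simps)
  \<comment> \<open>If \<open>r\<close> inverts \<open>t - w * y\<close>, then
    \<open>(1 + y * r * w) / t\<close> inverts \<open>t - y * w\<close>.\<close>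
  have "(t *\<^sub>R 1 - y * w) * (1 + y * r * w) = t *\<^sub>R 1 - y * w + t *\<^sub>R (y * r * w) - y * (w * (y * r)) * w"
    by (simp add: algebra_simps)
  also have "\<dots> = t *\<^sub>R 1" unfolding r1 by (simp add: algebra_simps)
  finally have 1: "(t *\<^sub>R 1 - y * w) * (1 + y * r * w) = t *\<^sub>R 1" .
  have "(1 + y * r * w) * (t *\<^sub>R 1 - y * w) = t *\<^sub>R 1 - y * w + t *\<^sub>R (y * r * w) - y * (r * (w * y)) * w"
    by (simp add: algebra_simps)
  also have "\<dots> = t *\<^sub>R 1" unfolding r2 by (simp add: algebra_simps)
  finally have 2: "(1 + y * r * w) * (t *\<^sub>R 1 - y * w) = t *\<^sub>R 1" .
  show "has_inverse (t *\<^sub>R 1 + - (y * star y))"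
    unfolding has_inverse_def using 1 2 t
    by (intro exI[of _ "(1/t) *\<^sub>R (1 + y * r * w)"]) (simp add: w_def)
qed (simp add: star_simps)

text \<open>Up to factors, \<open>h\<close> and \<open>k\<close> are the real and imaginary parts of
  \<open>y\<close>, and the sum is half of \<open>h * h + k * k\<close>.\<close>

lemma nonneg_star_mult_add_mult_star:
  fixes y :: "'a::unital_cstar_algebra"
  shows "nonneg (star y * y + y * star y)"
proof -
  define h where "h = y + star y"
  define k where "k = \<i> *\<^sub>C (y - star y)"
  have "star h = h" by (simp add: h_def star_simps add.commute)
  moreover have "star k = k"
    using scaleC_minus_one[of "\<i> *\<^sub>C (star y - y)"]
    by (simp add: k_def star_simps scaleC_scaleC scaleC_diff_right)
  ultimately have "nonneg ((1/2) *\<^sub>R (h * h + k * k))"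
    by (intro nonneg_scaleR nonneg_add nonneg_square) simp_all
  moreover have "k * k = - ((y - star y) * (y - star y))"
    using scaleC_minus_one[of "(y - star y) * (y - star y)"]
    by (simp add: k_def mult_scaleC_left mult_scaleC_right scaleC_scaleC)
  then have "h * h + k * k = 2 *\<^sub>R (star y * y + y * star y)"
    by (simp add: h_def algebra_simps scaleR_2)
  ultimately show ?thesis by simp
qed

lemma star_mult_self_negative_eq_0:
  fixes y :: "'a::unital_cstar_algebra"
  assumes "nonneg (- (star y * y))"
  shows "y = 0"
proof -
  have "nonneg ((star y * y + y * star y) + - (y * star y))"
    by (intro nonneg_add nonneg_star_mult_add_mult_star nonneg_minus_mult_star assms)
  then have "star y * y = 0" using assms by (intro nonneg_antisym) simp_all
  then show ?thesis by (rule star_mult_self_eq_0)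
qed

text \<open>
  With \<open>n\<close> twice the negative part of \<open>a = star x * x\<close>, the element \<open>y = x * n\<close> satisfies
  \<open>star y * y = n * a * n = - n ^ 3 / 2\<close>.
\<close>

lemma nonneg_star_mult_self:
  fixes x :: "'a::unital_cstar_algebra"
  shows "nonneg (star x * x)"
proof -
  define a where "a = star x * x"
  have a: "star a = a" by (simp add: a_def star_simps)
  obtain b where b: "nonneg b" "b * b = a * a" "bicommutes b (a * a)"
    using nonneg_square[OF a] by (rule nonneg_sqrt)
  have ab: "a * b = b * a" by (rule bicommutesD[OF b(3)]) (simp add: mult.assoc)
  define n where "n = b - a"
  have n: "nonneg n" unfolding n_def by (intro nonneg_diff_if_square_eq a b ab)
  then have sn: "star n = n" by (rule nonneg_star)
  \<comment> \<open>Since \<open>b * b = a * a\<close>, the square of \<open>b - a\<close> is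
    \<open>2 * a * a - 2 * a * b\<close>.\<close>
  have an: "n * n = (-2) *\<^sub>R (a * n)"
    by (simp add: n_def algebra_simps ab b(2) scaleR_2)
  have "nonneg ((1/2) *\<^sub>R (n * n * n))"
    using n sn by (intro nonneg_scaleR nonneg_mult nonneg_square) (simp_all add: mult.assoc)
  moreover have "n * (n * n) = (-2) *\<^sub>R (n * (a * n))" unfolding an by simp
  then have "star (x * n) * (x * n) = - ((1/2) *\<^sub>R (n * n * n))"
    by (simp add: star_simps sn a_def mult.assoc)
  ultimately have "x * n = 0" by (intro star_mult_self_negative_eq_0) simp
  then have "a * n = 0" by (simp add: a_def mult.assoc)
  then have "star n * n = 0" by (simp add: sn an)
  then have "n = 0" by (rule star_mult_self_eq_0)
  then show ?thesis using b(1) by (simp add: n_def a_def)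
qed

section \<open>Existence and uniqueness of positive square roots\<close>

lemma positive_iff_nonneg: "positive a \<longleftrightarrow> nonneg a"
proof
  assume "nonneg a"
  then obtain c where "nonneg c" "c * c = a" by (rule nonneg_sqrt)
  then show "positive a" by (auto simp: positive_def nonneg_star intro!: exI[of _ c])
qed (auto simp: positive_def nonneg_star_mult_self)

text \<open>
  For commuting square roots \<open>b\<close>, \<open>c\<close> and \<open>d = b - c\<close>, the positive elements \<open>d * b * d\<close> and
  \<open>d * c * d\<close> add up to \<open>d * (b * b - c * c) = 0\<close>, so both vanish, and hence so does their
  difference \<open>d * d * d\<close>.
\<close>

lemma nonneg_sqrt_unique:
  fixes b c :: "'a::unital_cstar_algebra"
  assumes b: "nonneg b" and c: "nonneg c" and bc: "b * c = c * b" and eq: "b * b = c * c"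
  shows "b = c"
proof -
  define d where "d = b - c"
  have sd: "star d = d" by (simp add: d_def star_simps nonneg_star b c)
  have db: "d * b = b * d" and dc: "d * c = c * d" by (simp_all add: d_def algebra_simps bc)
  have "d * d * b = b * (d * d)" "d * d * c = c * (d * d)" by (metis db dc mult.assoc)+
  then have "nonneg (d * d * b)" "nonneg (d * d * c)"
    by (simp_all only: nonneg_mult nonneg_square sd b c)
  moreover have "d * (b + c) = 0" by (simp add: d_def algebra_simps bc eq)
  then have "d * d * b + d * d * c = 0"
    by (metis distrib_left mult.assoc mult_zero_right)
  then have "d * d * c = - (d * d * b)" by (simp add: eq_neg_iff_add_eq_0 add.commute)
  ultimately have "d * d * b = 0" "d * d * c = 0"
    using nonneg_antisym[of "d * d * b"] by simp_all
  then have "d * d * d = 0" by (simp add: d_def right_diff_distrib)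
  then have "star (d * d) * (d * d) = 0" by (simp add: star_simps sd flip: mult.assoc)
  then have "star d * d = 0" using star_mult_self_eq_0[of "d * d"] by (simp add: sd)
  then have "d = 0" by (rule star_mult_self_eq_0)
  then show ?thesis by (simp add: d_def)
qed

text \<open>Any root \<open>b\<close> commutes with \<open>b * b = a\<close>, hence with the
  bicommuting root \<open>c\<close>, so uniqueness among commuting roots suffices.\<close>

lemma pos_sqrt:
  assumes "positive a"
  shows "star (pos_sqrt a) = pos_sqrt a" "pos_sqrt a * pos_sqrt a = a"
proof -
  obtain c where c: "nonneg c" "c * c = a" "bicommutes c a"
    using assms unfolding positive_iff_nonneg by (rule nonneg_sqrt)
  have "pos_sqrt a = c" unfolding pos_sqrt_def
  proof (rule the_equality)
    fix b assume b: "positive b \<and> b * b = a"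
    then have "b * a = a * b" by (metis mult.assoc)
    then have "b * c = c * b" by (rule bicommutesD[OF c(3)])
    moreover have "nonneg b" "b * b = c * c" using b c(2) by (simp_all add: positive_iff_nonneg)
    ultimately show "b = c" using c(1) nonneg_sqrt_unique by blast
  qed (simp add: c positive_iff_nonneg)
  then show "star (pos_sqrt a) = pos_sqrt a" "pos_sqrt a * pos_sqrt a = a"
    using c by (simp_all add: nonneg_star)
qed

section \<open>Conditional states\<close>

text \<open>With \<open>s = pos_sqrt a\<close>, compression sends \<open>star x * x\<close> to
  \<open>star (x * s) * (x * s)\<close>, so positivity survives; it sends 1 to \<open>a\<close>,
  which explains the divisor.\<close>

lemma state_compress:
  fixes f :: "'a::unital_cstar_algebra \<Rightarrow> complex" and a :: 'a
  assumes f: "state f" and a: "positive a" "f a \<noteq> 0"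
  shows "state (\<lambda>b. f (pos_sqrt a * b * pos_sqrt a) / f a)"
proof -
  let ?s = "pos_sqrt a"
  have lin: "Vector_Spaces.linear scaleC scaleC f" using f by (simp add: state_def)
  interpret f: Vector_Spaces.linear scaleC scaleC f by (rule lin)
  obtain r where r: "0 \<le> r" "f a = complex_of_real r"
    using f a(1) by (auto simp: state_def positive_complex_iff)
  have "Vector_Spaces.linear scaleC scaleC (\<lambda>b. f (?s * b * ?s) / f a)"
    using vector_space_scaleC[where ?'a = 'a] vector_space_scaleC[where ?'a = complex]
    by (simp add: Vector_Spaces.linear_iff distrib_left distrib_right f.add add_divide_distrib
      mult_scaleC_left mult_scaleC_right f.scale scaleC_complex_def)
  moreover have "positive (f (?s * b * ?s) / f a)" if b: "positive b" for b
  proof -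
    obtain x where "b = star x * x" using b by (auto simp: positive_def)
    then have "?s * b * ?s = star (x * ?s) * (x * ?s)"
      by (simp add: star_simps pos_sqrt[OF a(1)] mult.assoc)
    then have "positive (?s * b * ?s)" unfolding positive_def by blast
    then obtain q where "0 \<le> q" "f (?s * b * ?s) = complex_of_real q"
      using f by (auto simp: state_def positive_complex_iff)
    then show ?thesis
      using r by (auto simp: positive_complex_iff intro!: exI[of _ "q / r"])
  qed
  ultimately show ?thesis using a by (simp add: state_def pos_sqrt)
qed

theorem corollary12:
  fixes f :: "'b::fd_cstar_algebra \<Rightarrow> complex" and e :: 'b
  assumes "state f" and "effect e"
    and "f e \<noteq> 0" and "f e \<noteq> 1"
  shows "(\<exists>!p. case p of (g, h) \<Rightarrow>
             state g \<and> state h \<and> char_map (f e) \<circ> map_prod g h = f \<circ> char_map e) \<and>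
         (\<forall>g h. state g \<and> state h \<and> char_map (f e) \<circ> map_prod g h = f \<circ> char_map e \<longrightarrow>
             (\<forall>b. g b = f (pos_sqrt e * b * pos_sqrt e) / f e) \<and>
             (\<forall>b. h b = f (pos_sqrt (1 - e) * b * pos_sqrt (1 - e)) / f (1 - e)))"
proof -
  define g0 where "g0 b = f (pos_sqrt e * b * pos_sqrt e) / f e" for b
  define h0 where "h0 b = f (pos_sqrt (1 - e) * b * pos_sqrt (1 - e)) / f (1 - e)" for b
  interpret f: Vector_Spaces.linear scaleC scaleC f using assms(1) by (simp add: state_def)
  have e: "positive e" "positive (1 - e)" using assms(2) by (simp_all add: effect_def)
  have f1: "f (1 - e) = 1 - f e" using assms(1) by (simp add: f.diff state_def)
  obtain r where r: "0 \<le> r" "f e = complex_of_real r"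
    using assms(1) e by (auto simp: state_def positive_complex_iff)
  \<comment> \<open>Positivity of \<open>f (1 - e)\<close> puts \<open>r\<close> into the unit
    interval, where \<open>char_map (f e)\<close> is a convex combination.\<close>
  have "positive (1 - f e)" using assms(1) e f1 unfolding state_def by metis
  then have "0 \<le> Re (1 - f e)" by (metis Re_complex_of_real positive_complex_iff)
  then have "r \<le> 1" by (simp add: r)
  then have ch: "char_map (f e) (z, z') = f e * z + f (1 - e) * z'" for z z'
    using char_map_complex[of r] r f1 by simp
  have states: "state g0" "state h0"
    unfolding g0_def h0_def using assms e f1 by (intro state_compress; simp)+
  have "char_map (f e) (g0 a, h0 b) = f (char_map e (a, b))" for a b
    using assms(3,4) unfolding ch by (simp add: g0_def h0_def char_map_def f.add f1)
  then have sol: "char_map (f e) \<circ> map_prod g0 h0 = f \<circ> char_map e" by auto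
  have uniq: "g = g0 \<and> h = h0"
    if "state g" "state h" and eq: "char_map (f e) \<circ> map_prod g h = f \<circ> char_map e" for g h
  proof -
    interpret g: Vector_Spaces.linear scaleC scaleC g using that by (simp add: state_def)
    interpret h: Vector_Spaces.linear scaleC scaleC h using that by (simp add: state_def)
    have *: "f e * g a + f (1 - e) * h b = f (char_map e (a, b))" for a b
      using fun_cong[OF eq, of "(a, b)"] by (simp add: ch)
    have "g a = g0 a" for a
      using *[of a 0] assms(3) by (simp add: g0_def char_map_def h.zero field_simps)
    moreover have "h b = h0 b" for b
    proof -
      have "f (1 - e) * h b = f (pos_sqrt (1 - e) * b * pos_sqrt (1 - e))"
        using *[of 0 b] by (simp add: char_map_def g.zero)
      moreover have "f (1 - e) \<noteq> 0" using assms(4) f1 by simp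
      ultimately show ?thesis unfolding h0_def by (metis nonzero_mult_div_cancel_left)
    qed
    ultimately show ?thesis by blast
  qed
  show ?thesis
  proof (intro conjI)
    show "\<exists>!p. case p of (g, h) \<Rightarrow>
        state g \<and> state h \<and> char_map (f e) \<circ> map_prod g h = f \<circ> char_map e"
    proof (rule ex1I[of _ "(g0, h0)"])
      fix p
      assume "case p of (g, h) \<Rightarrow>
        state g \<and> state h \<and> char_map (f e) \<circ> map_prod g h = f \<circ> char_map e"
      then show "p = (g0, h0)" using uniq by (cases p) blast
    qed (simp only: prod.case states sol simp_thms)
    show "\<forall>g h. state g \<and> state h \<and> char_map (f e) \<circ> map_prod g h = f \<circ> char_map e \<longrightarrow>
        (\<forall>b. g b = f (pos_sqrt e * b * pos_sqrt e) / f e) \<and>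
        (\<forall>b. h b = f (pos_sqrt (1 - e) * b * pos_sqrt (1 - e)) / f (1 - e))"
      using uniq unfolding g0_def h0_def by blast
  qed
qed

end
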